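(* Let $M$ be a strongly bounded finite Puiseux monoid. Then $M$ is atomic if and only if $M$ is isomorphic to a numerical semigroup.
   Context: A Puiseux monoid is an additive submonoid of $\mathbb{Q}_{\ge 0}$. For $r\in\mathbb{Q}_{>0}$, $\mathsf{n}(r)$ is the numerator of $r$ written in lowest terms with positive numerator and denominator. A set $S$ of positive rationals is strongly bounded if $\{\mathsf{n}(s)\mid s\in S\}$ is bounded. A Puiseux monoid is strongly bounded if it can be generated (as a monoid) by a strongly bounded set. For a prime $p$, $\mathsf{v}_p$ is the $p$-adic valuation on $\mathbb{Q}$ (with $\mathsf{v}_p(0)=\infty$). For a set of primes $P$, a Puiseux monoid over $P$ is a Puiseux monoid $M$ such that $\mathsf{v}_p(m)\ge 0$ for every $m\in M$ and every prime $p\notin P$. A Puiseux monoid is called finite if there is a finite set of primes $P$ such that it is a Puiseux monoid over $P$ (this does not mean finite cardinality). An atom of $M$ is a nonzero $a\in M$ such that $a=x+y$ with $x,y\in M$ implies $x=0$ or $y=0$; $M$ is atomic if every nonzero element of $M$ is a finite sum of atoms. A numerical semigroup is a submonoid $N$ of $(\mathbb{N}_0,+)$, where $\mathbb{N}_0$ is the set of non-negative integers, such that $\mathbb{N}_0\setminus N$ is finite. Isomorphic means isomorphic as monoids.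
   Formalization: The Puiseux monoid M is assumed to be different from {0}: the trivial monoid is strongly bounded, finite and vacuously atomic, but is not isomorphic to any numerical semigroup, since these are cofinite and hence infinite. *)

theory Defs
  imports
    Complex_Main
    "HOL-Library.Multiset"
    "HOL-Library.Extended"
    "HOL-Computational_Algebra.Primes"
    "HOL-Algebra.Group"
begin

definition additive :: "'a::comm_monoid_add set \<Rightarrow> 'a monoid"
  where "additive A = \<lparr>carrier = A, mult = (+), one = 0\<rparr>"

definition puiseux_monoid :: "rat set \<Rightarrow> bool"
  where "puiseux_monoid M \<longleftrightarrow> submonoid M (additive {0..})"

definition numerator :: "rat \<Rightarrow> int"
  where "numerator r = fst (quotient_of r)"

definition denominator :: "rat \<Rightarrow> int"
  where "denominator r = snd (quotient_of r)"

text \<open>Numerators of positive rationals are positive, so bounded means bounded above.\<close>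

definition strongly_bounded_set :: "rat set \<Rightarrow> bool"
  where "strongly_bounded_set S \<longleftrightarrow> S \<subseteq> {0<..} \<and> bdd_above (numerator ` S)"

definition strongly_bounded :: "rat set \<Rightarrow> bool"
  where "strongly_bounded M \<longleftrightarrow>
    puiseux_monoid M \<and> (\<exists>S. strongly_bounded_set S \<and> M = puiseux_monoid hull S)"

definition padic_val :: "nat \<Rightarrow> rat \<Rightarrow> int extended"
  where "padic_val p r =
    (if r = 0 then \<infinity>
     else Fin (int (multiplicity (int p) (numerator r)) - int (multiplicity (int p) (denominator r))))"

definition puiseux_monoid_over :: "nat set \<Rightarrow> rat set \<Rightarrow> bool"
  where "puiseux_monoid_over P M \<longleftrightarrow>
    puiseux_monoid M \<and> (\<forall>m\<in>M. \<forall>p. prime p \<and> p \<notin> P \<longrightarrow> 0 \<le> padic_val p m)"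

definition finite_puiseux_monoid :: "rat set \<Rightarrow> bool"
  where "finite_puiseux_monoid M \<longleftrightarrow>
    (\<exists>P. finite P \<and> (\<forall>p\<in>P. prime p) \<and> puiseux_monoid_over P M)"

definition atoms :: "rat set \<Rightarrow> rat set"
  where "atoms M = {a \<in> M. a \<noteq> 0 \<and> (\<forall>x\<in>M. \<forall>y\<in>M. a = x + y \<longrightarrow> x = 0 \<or> y = 0)}"

definition atomic :: "rat set \<Rightarrow> bool"
  where "atomic M \<longleftrightarrow> (\<forall>m\<in>M. m \<noteq> 0 \<longrightarrow> (\<exists>A. set_mset A \<subseteq> atoms M \<and> m = \<Sum>\<^sub># A))"

text \<open>
  The trivial monoid is (vacuously) atomic but, by cofiniteness, not isomorphic to a numerical
  semigroup; the main theorem is therefore about nontrivial monoids.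
\<close>

definition numerical_semigroup :: "nat set \<Rightarrow> bool"
  where "numerical_semigroup N \<longleftrightarrow> submonoid N (additive UNIV) \<and> finite (UNIV - N)"

text \<open>
  Library isomorphisms \<open>\<cong>\<close> are bijections compatible with the operation only; between monoids
  they automatically preserve the identity, so this is monoid isomorphism.
\<close>

definition isomorphic_to_numerical_semigroup :: "rat set \<Rightarrow> bool"
  where "isomorphic_to_numerical_semigroup M \<longleftrightarrow>
    (\<exists>N. numerical_semigroup N \<and> additive M \<cong> additive N)"

end

theory Submission
  imports Defs
begin

text \<open>
  Atomic implies isomorphic to a numerical semigroup. An atom of a monoid lies in every generating
  set, so the numerators of the atoms are bounded. If there were infinitely many atoms, infinitely
  many of them would share a numerator \<open>n\<close>; their denominators involve only finitely many primes,
  so by Dickson's lemma one of these denominators, \<open>d\<close>, properly divides another one, \<open>d'\<close>.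
  Then \<open>n/d = (d'/d) \<cdot> (n/d')\<close> writes the atom \<open>n/d\<close> as a sum of at least two nonzero elements,
  which is absurd (\<open>finite_atoms\<close>). Hence an atomic \<open>M\<close> has a common denominator, that is,
  \<open>M\<close> is a rescaled submonoid of the natural numbers, and every nontrivial submonoid of the natural
  numbers is a multiple of a numerical semigroup
  (\<open>nat_submonoid_eq_multiple_of_numerical_semigroup\<close>).

  Conversely, an isomorphism to a numerical semigroup is an additive function with values in the
  natural numbers that vanishes only at \<open>0\<close>. Along it every proper decomposition strictly
  decreases, so decomposing must stop, at atoms (\<open>atomic_if_nat_valued_additive\<close>).
\<close>

section \<open>Submonoids, atoms and generators\<close>

lemma puiseux_monoid_iff:
  "puiseux_monoid M \<longleftrightarrow> (\<forall>x\<in>M. 0 \<le> x) \<and> 0 \<in> M \<and> (\<forall>x\<in>M. \<forall>y\<in>M. x + y \<in> M)"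
  by (auto simp: puiseux_monoid_def submonoid_def additive_def)

lemma submonoid_additive_UNIV_iff:
  "submonoid N (additive UNIV) \<longleftrightarrow> 0 \<in> N \<and> (\<forall>x\<in>N. \<forall>y\<in>N. x + y \<in> N)"
  by (auto simp: submonoid_def additive_def)

lemma closed_of_nat_mult:
  fixes x :: "'a::comm_semiring_1"
  assumes "0 \<in> M" "\<And>x y. x \<in> M \<Longrightarrow> y \<in> M \<Longrightarrow> x + y \<in> M" "x \<in> M"
  shows "of_nat k * x \<in> M"
  using assms by (induction k) (auto simp: distrib_right)

text \<open>
  Removing an atom from a monoid leaves a submonoid, because the atom is not a sum of two other
  elements; a generating set cannot fit into this smaller submonoid.
\<close>

lemma atoms_subset_generators:
  assumes "M = puiseux_monoid hull S" "puiseux_monoid M"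
  shows "atoms M \<subseteq> S"
proof
  fix a assume a: "a \<in> atoms M"
  show "a \<in> S"
  proof (rule ccontr)
    assume "a \<notin> S"
    then have "S \<subseteq> M - {a}"
      using assms(1) hull_subset[of S puiseux_monoid] by auto
    moreover have "x + y \<noteq> a" if "x \<in> M" "y \<in> M" "x \<noteq> a" "y \<noteq> a" for x y
    proof
      assume eq: "x + y = a"
      with a that(1,2) have "x = 0 \<or> y = 0"
        unfolding atoms_def by blast
      with eq that(3,4) show False by auto
    qed
    then have "puiseux_monoid (M - {a})"
      using assms(2) a by (auto simp: puiseux_monoid_iff atoms_def)
    ultimately have "puiseux_monoid hull S \<subseteq> M - {a}"
      by (rule hull_minimal)
    with a assms(1) show False
      by (auto simp: atoms_def)
  qed
qed

lemma atom_not_proper_multiple: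
  assumes "puiseux_monoid M" "x \<in> M" "k \<ge> 2"
  shows "of_nat k * x \<notin> atoms M"
proof
  assume a: "of_nat k * x \<in> atoms M"
  then have "x \<noteq> 0"
    by (auto simp: atoms_def)
  have eq: "of_nat k * x = x + of_nat (k - 1) * x"
    using assms(3) by (simp add: algebra_simps of_nat_diff)
  have "of_nat (k - 1) * x \<in> M"
    using assms(1,2) by (intro closed_of_nat_mult) (auto simp: puiseux_monoid_iff)
  with a eq assms(2) have "x = 0 \<or> of_nat (k - 1) * x = 0"
    unfolding atoms_def by blast
  with \<open>x \<noteq> 0\<close> assms(3) show False
    by simp
qed

section \<open>Dickson's lemma\<close>

lemma nondecreasing_subsequence:
  fixes h :: "nat \<Rightarrow> nat"
  shows "\<exists>r. strict_mono r \<and> incseq (h \<circ> r)"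
proof -
  obtain r :: "nat \<Rightarrow> nat" where r: "strict_mono r" and mono: "monoseq (\<lambda>n. h (r n))"
    using seq_monosub[of h] by blast
  show ?thesis
  proof (cases "incseq (h \<circ> r)")
    case True
    with r show ?thesis by blast
  next
    case False
    with mono have dec: "decseq (h \<circ> r)"
      by (simp add: monoseq_iff comp_def)
    \<comment> \<open>A decreasing sequence of natural numbers is constant from where its minimum is attained.\<close>
    define m where "m = (LEAST v. v \<in> range (h \<circ> r))"
    have "m \<in> range (h \<circ> r)"
      unfolding m_def by (rule LeastI[of _ "(h \<circ> r) 0"]) blast
    then obtain k where k: "(h \<circ> r) k = m"
      by auto
    have ge: "m \<le> (h \<circ> r) i" for i
      unfolding m_def by (rule Least_le) blast
    have const: "(h \<circ> r) (i + k) = m" for i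
      using decseqD[OF dec, of k "i + k"] ge[of "i + k"] k by simp
    have "strict_mono (\<lambda>i. r (i + k))"
      using r by (simp add: strict_mono_def)
    moreover have "incseq (h \<circ> (\<lambda>i. r (i + k)))"
      using const by (simp add: incseq_def)
    ultimately show ?thesis by blast
  qed
qed

lemma simultaneously_nondecreasing_subsequence:
  fixes f :: "'p \<Rightarrow> nat \<Rightarrow> nat"
  assumes "finite P"
  shows "\<exists>r. strict_mono r \<and> (\<forall>p\<in>P. incseq (f p \<circ> r))"
  using assms
proof (induction P rule: finite_induct)
  case empty
  show ?case
    by (rule exI[of _ id]) (simp add: strict_mono_def)
next
  case (insert q P)
  then obtain r where r: "strict_mono r" "\<forall>p\<in>P. incseq (f p \<circ> r)"
    by blast
  obtain s where s: "strict_mono s" "incseq ((f q \<circ> r) \<circ> s)"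
    using nondecreasing_subsequence by blast
  have "incseq (f p \<circ> (r \<circ> s))" if "p \<in> P" for p
    using r(2) that s(1) by (auto simp: incseq_def strict_mono_less_eq)
  moreover have "strict_mono (r \<circ> s)"
    using r(1) s(1) by (rule strict_mono_o)
  ultimately show ?case
    using s(2) unfolding comp_assoc by blast
qed

lemma dickson:
  fixes f :: "'p \<Rightarrow> 'a \<Rightarrow> nat"
  assumes "finite P" "infinite A"
  shows "\<exists>x\<in>A. \<exists>y\<in>A. x \<noteq> y \<and> (\<forall>p\<in>P. f p x \<le> f p y)"
proof -
  obtain s :: "nat \<Rightarrow> 'a" where s: "inj s" "range s \<subseteq> A"
    using infinite_countable_subset[OF assms(2)] by blast
  obtain r where r: "strict_mono r" "\<forall>p\<in>P. incseq ((f p \<circ> s) \<circ> r)"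
    using simultaneously_nondecreasing_subsequence[OF assms(1), of "\<lambda>p. f p \<circ> s"] by blast
  have "r 0 < r 1"
    using r(1) by (simp add: strict_mono_def)
  then have "s (r 0) \<noteq> s (r 1)"
    using s(1) by (auto dest: injD)
  moreover have "f p (s (r 0)) \<le> f p (s (r 1))" if "p \<in> P" for p
    using r(2) that by (auto simp: incseq_def)
  ultimately show ?thesis
    using s(2) by blast
qed

section \<open>Finiteness of the set of atoms\<close>

lemma rat_eq_numerator_div_denominator: "r = of_int (numerator r) / of_int (denominator r)"
  by (simp add: numerator_def denominator_def quotient_of_div)

lemma denominator_pos: "denominator r > 0"
  by (simp add: denominator_def quotient_of_denom_pos')

lemma coprime_numerator_denominator: "coprime (numerator r) (denominator r)"
  by (simp add: numerator_def denominator_def quotient_of_coprime prod.expand)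

lemma numerator_pos: "r > 0 \<Longrightarrow> numerator r > 0"
  using rat_eq_numerator_div_denominator[of r] denominator_pos[of r]
  by (metis of_int_0_less_iff zero_less_divide_iff less_asym)

lemma prime_dvd_denominator_imp_mem:
  assumes "puiseux_monoid_over P M" "m \<in> M" "prime p" "int p dvd denominator m"
  shows "p \<in> P"
proof (rule ccontr)
  assume "p \<notin> P"
  with assms have val: "0 \<le> padic_val p m"
    by (auto simp: puiseux_monoid_over_def)
  have "prime (int p)"
    using assms(3) by simp
  have "m \<noteq> 0"
    using assms(3,4) by (auto simp: denominator_def)
  have "\<not> int p dvd numerator m"
    using coprime_numerator_denominator[of m] assms(4) \<open>prime (int p)\<close>
    by (meson coprime_common_divisor not_prime_unit)
  then have "multiplicity (int p) (numerator m) = 0"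
    by (rule not_dvd_imp_multiplicity_0)
  moreover have "multiplicity (int p) (denominator m) > 0"
    using assms(4) \<open>prime (int p)\<close> denominator_pos[of m]
    by (simp add: prime_multiplicity_gt_zero_iff)
  ultimately show False
    using val \<open>m \<noteq> 0\<close> by (simp add: padic_val_def zero_extended_def)
qed

text \<open>
  With equal numerators, comparability of the denominators at the finitely many relevant primes
  is divisibility of the denominators, so it makes one element a multiple of the other.
\<close>

lemma finite_atoms:
  assumes "strongly_bounded M" "finite_puiseux_monoid M"
  shows "finite (atoms M)"
proof (rule ccontr)
  assume inf: "infinite (atoms M)"
  from assms(1) obtain S where M: "puiseux_monoid M" "M = puiseux_monoid hull S"
    and S: "S \<subseteq> {0<..}" "bdd_above (numerator ` S)"
    by (auto simp: strongly_bounded_def strongly_bounded_set_def)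
  from assms(2) obtain P where P: "finite P" "puiseux_monoid_over P M"
    by (auto simp: finite_puiseux_monoid_def)
  have AS: "atoms M \<subseteq> S"
    using M by (intro atoms_subset_generators)
  obtain B where B: "\<And>s. s \<in> S \<Longrightarrow> numerator s \<le> B"
    using S(2) by (auto simp: bdd_above_def)
  have "numerator ` atoms M \<subseteq> {0..B}"
    using AS S(1) B numerator_pos by force
  then have "finite (numerator ` atoms M)"
    using finite_subset by blast
  from pigeonhole_infinite[OF inf this] obtain a0
    where "infinite {a \<in> atoms M. numerator a = numerator a0}"
    by blast
  from dickson[OF P(1) this, of "\<lambda>p a. multiplicity (int p) (denominator a)"]
  obtain x y where xy: "x \<in> atoms M" "y \<in> atoms M" "numerator x = numerator y" "x \<noteq> y"
    and le: "\<forall>p\<in>P. multiplicity (int p) (denominator x) \<le> multiplicity (int p) (denominator y)"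
    by auto
  have "denominator x dvd denominator y"
  proof (rule multiplicity_le_imp_dvd)
    show "denominator x \<noteq> 0"
      using denominator_pos[of x] by simp
    fix q :: int assume "prime q"
    then obtain p where p: "q = int p" "prime p"
      by (metis prime_ge_0_int nonneg_int_cases prime_int_nat_transfer nat_int)
    show "multiplicity q (denominator x) \<le> multiplicity q (denominator y)"
    proof (cases "p \<in> P")
      case True
      with le p(1) show ?thesis by simp
    next
      case False
      with prime_dvd_denominator_imp_mem[OF P(2) _ p(2)] xy(1) have "\<not> q dvd denominator x"
        by (auto simp: p(1) atoms_def)
      then show ?thesis
        by (simp add: not_dvd_imp_multiplicity_0)
    qed
  qed
  then obtain c where c: "denominator y = denominator x * c"
    by (elim dvdE)
  have "c > 0"
    using c denominator_pos[of x] denominator_pos[of y] by (simp add: zero_less_mult_iff)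
  have "c \<noteq> 1"
    using c xy(3,4) rat_eq_numerator_div_denominator[of x] rat_eq_numerator_div_denominator[of y]
    by auto
  with \<open>c > 0\<close> have "nat c \<ge> 2"
    by simp
  have "x = of_int (numerator x) / of_int (denominator x)"
    by (rule rat_eq_numerator_div_denominator)
  also have "\<dots> = of_int c * (of_int (numerator y) / of_int (denominator y))"
    using c xy(3) \<open>c > 0\<close> by simp
  also have "\<dots> = of_int c * y"
    by (simp flip: rat_eq_numerator_div_denominator)
  finally have "x = of_nat (nat c) * y"
    using \<open>c > 0\<close> by simp
  moreover have "y \<in> M"
    using xy(2) by (simp add: atoms_def)
  ultimately show False
    using atom_not_proper_multiple[OF M(1) _ \<open>nat c \<ge> 2\<close>, of y] xy(1) by metis
qed

section \<open>Submonoids of the natural numbers\<close>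

text \<open>
  For \<open>k > 0\<close>, division with remainder writes \<open>n = q k + r = (q - r) k + r (k + 1)\<close>, and
  \<open>r < k \<le> q\<close> once \<open>n \<ge> k\<^sup>2\<close>.
\<close>

lemma numerical_semigroup_if_consecutive:
  assumes "submonoid N (additive UNIV)" "k \<in> N" "Suc k \<in> N"
  shows "numerical_semigroup N"
proof -
  have N: "0 \<in> N" "\<And>x y. x \<in> N \<Longrightarrow> y \<in> N \<Longrightarrow> x + y \<in> N"
    using assms(1) by (auto simp: submonoid_additive_UNIV_iff)
  have comb: "a * k + b * Suc k \<in> N" for a b
    using closed_of_nat_mult[OF N assms(2), of a] closed_of_nat_mult[OF N assms(3), of b] N(2)
    by simp
  have "n \<in> N" if "n \<ge> k * k" for n
  proof (cases "k = 0")
    case True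
    with comb[of 0 n] show ?thesis by simp
  next
    case False
    define q r where "q = n div k" and "r = n mod k"
    have n: "n = q * k + r"
      by (simp add: q_def r_def)
    have "r < k"
      using False by (simp add: r_def)
    moreover have "k \<le> q"
      using that False by (simp add: q_def less_eq_div_iff_mult_less_eq)
    ultimately have "(q - r) * k + r * Suc k = n"
      by (simp add: n diff_mult_distrib)
    with comb[of "q - r" r] show ?thesis by simp
  qed
  then have "UNIV - N \<subseteq> {..<k * k}"
    by (meson DiffD2 lessThan_iff not_le subsetI)
  then show ?thesis
    using assms(1) finite_subset by (auto simp: numerical_semigroup_def)
qed

text \<open>
  The differences of elements of \<open>H\<close> form a subgroup of the integers. It is generated by its least
  positive element \<open>g\<close>, so \<open>g\<close> divides all of \<open>H\<close>; and \<open>g\<close> being a difference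
  of two elements of \<open>H\<close>, their quotients by \<open>g\<close> are consecutive.
\<close>

lemma nat_submonoid_eq_multiple_of_numerical_semigroup:
  fixes H :: "nat set"
  assumes "submonoid H (additive UNIV)" "H \<noteq> {0}"
  shows "\<exists>g N. g > 0 \<and> numerical_semigroup N \<and> H = (\<lambda>n. g * n) ` N"
proof -
  have H: "0 \<in> H" "\<And>x y. x \<in> H \<Longrightarrow> y \<in> H \<Longrightarrow> x + y \<in> H"
    using assms(1) by (auto simp: submonoid_additive_UNIV_iff)
  define is_diff where "is_diff d \<longleftrightarrow> d > 0 \<and> (\<exists>y\<in>H. y + d \<in> H)" for d
  obtain h where "h \<in> H" "h > 0"
    using H(1) assms(2) by blast
  then have "is_diff h"
    using H(1) by (auto simp: is_diff_def intro!: bexI[of _ 0])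
  define g where "g = (LEAST d. is_diff d)"
  have "is_diff g"
    unfolding g_def using \<open>is_diff h\<close> by (rule LeastI)
  then obtain y where g: "g > 0" "y \<in> H" "y + g \<in> H"
    by (auto simp: is_diff_def)
  have dvd: "g dvd n" if "n \<in> H" for n
  proof (rule ccontr)
    assume "\<not> g dvd n"
    then have pos: "n mod g > 0"
      by (simp add: dvd_eq_mod_eq_0)
    define q where "q = n div g"
    have "q * (y + g) + n mod g = n + q * y"
      by (simp add: q_def distrib_left)
    moreover have "q * (y + g) \<in> H" "n + q * y \<in> H"
      using closed_of_nat_mult[OF H g(2), of q] closed_of_nat_mult[OF H g(3), of q] H(2)[OF that]
      by simp_all
    ultimately have "is_diff (n mod g)"
      using pos by (auto simp: is_diff_def intro!: bexI[of _ "q * (y + g)"])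
    then have "g \<le> n mod g"
      unfolding g_def by (rule Least_le)
    moreover have "n mod g < g"
      using g(1) by simp
    ultimately show False
      by simp
  qed
  define N where "N = {n. g * n \<in> H}"
  obtain k where k: "y = g * k"
    using dvd[OF g(2)] by (elim dvdE)
  have "submonoid N (additive UNIV)"
    using H by (auto simp: submonoid_additive_UNIV_iff N_def distrib_left)
  moreover have "k \<in> N" "Suc k \<in> N"
    using g(2,3) k by (simp_all add: N_def add.commute)
  ultimately have "numerical_semigroup N"
    by (rule numerical_semigroup_if_consecutive)
  moreover have "H = (\<lambda>n. g * n) ` N"
    using dvd by (auto simp: N_def elim!: dvdE)
  ultimately show ?thesis
    using g(1) by blast
qed

section \<open>From atomic monoids to numerical semigroups\<close>

lemma common_denominator:
  assumes "finite A"
  shows "\<exists>D::nat. D > 0 \<and> (\<forall>a\<in>A. of_nat D * a \<in> (\<int> :: rat set))"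
  using assms
proof (induction A rule: finite_induct)
  case empty
  show ?case by (rule exI[of _ 1]) simp
next
  case (insert a A)
  then obtain D :: nat where D: "D > 0" "\<forall>a\<in>A. of_nat D * a \<in> (\<int> :: rat set)"
    by blast
  define d where "d = nat (denominator a)"
  have d: "d > 0" "of_nat d * a = of_int (numerator a)"
    using denominator_pos[of a] rat_eq_numerator_div_denominator[of a]
    by (simp_all add: d_def field_simps)
  have "of_nat (d * D) * b \<in> \<int>" if "b \<in> insert a A" for b
  proof (cases "b = a")
    case True
    have "of_nat (d * D) * a = of_nat D * (of_nat d * a)"
      by simp
    also have "\<dots> \<in> \<int>"
      unfolding d(2) by simp
    finally show ?thesis
      using True by simp
  next
    case False
    with that D(2) have "of_nat D * b \<in> \<int>"
      by blast
    then have "of_nat d * (of_nat D * b) \<in> \<int>"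
      by (rule Ints_mult[OF Ints_of_nat])
    then show ?thesis
      by (simp only: of_nat_mult mult.assoc)
  qed
  with d(1) D(1) show ?case
    by (intro exI[of _ "d * D"]) simp
qed

lemma isomorphic_to_numerical_semigroup_if_scaled:
  assumes "c \<noteq> 0" "numerical_semigroup N" "M = (\<lambda>n. of_nat n * c) ` N"
  shows "isomorphic_to_numerical_semigroup M"
proof -
  let ?f = "\<lambda>n. of_nat n * c"
  let ?g = "inv_into N ?f"
  have N: "\<And>x y. x \<in> N \<Longrightarrow> y \<in> N \<Longrightarrow> x + y \<in> N"
    using assms(2) by (auto simp: numerical_semigroup_def submonoid_additive_UNIV_iff)
  have inj: "inj_on ?f N"
    using assms(1) by (auto intro: inj_onI)
  have "bij_betw ?g M N"
    using inj assms(3) by (intro bij_betw_inv_into) (simp add: bij_betw_def)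
  moreover have "?g (x + y) = ?g x + ?g y" if "x \<in> M" "y \<in> M" for x y
  proof -
    from that assms(3) obtain m n where "m \<in> N" "x = ?f m" "n \<in> N" "y = ?f n"
      by blast
    moreover from this have "x + y = ?f (m + n)"
      by (simp add: distrib_right)
    ultimately show ?thesis
      using inv_into_f_f[OF inj] N by metis
  qed
  ultimately have "?g \<in> iso (additive M) (additive N)"
    by (auto simp: iso_def hom_def additive_def bij_betw_def)
  then show ?thesis
    using assms(2) by (auto simp: isomorphic_to_numerical_semigroup_def is_iso_def)
qed

lemma isomorphic_to_numerical_semigroup_if_finite_atoms:
  assumes "puiseux_monoid M" "M \<noteq> {0}" "atomic M" "finite (atoms M)"
  shows "isomorphic_to_numerical_semigroup M"
proof -
  have M: "0 \<in> M" "\<And>x y. x \<in> M \<Longrightarrow> y \<in> M \<Longrightarrow> x + y \<in> M" "\<And>x. x \<in> M \<Longrightarrow> x \<ge> 0"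
    using assms(1) by (auto simp: puiseux_monoid_iff)
  obtain D :: nat where D: "D > 0" "\<forall>a\<in>atoms M. of_nat D * a \<in> \<int>"
    using common_denominator[OF assms(4)] by blast
  have int_sum: "of_nat D * (\<Sum>\<^sub># A) \<in> \<int>" if "set_mset A \<subseteq> atoms M" for A
    using that by (induction A) (use D(2) in \<open>auto simp: distrib_left\<close>)
  have nat: "\<exists>n. m = of_nat n / of_nat D" if "m \<in> M" for m
  proof -
    have "of_nat D * m \<in> \<int>"
    proof (cases "m = 0")
      case False
      with assms(3) that int_sum show ?thesis
        by (force simp: atomic_def)
    qed simp
    moreover have "of_nat D * m \<ge> 0"
      using M(3)[OF that] by simp
    ultimately have "of_nat D * m \<in> \<nat>"
      by (simp add: Nats_altdef2)
    then obtain n where "of_nat D * m = of_nat n"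
      by (elim Nats_cases)
    with D(1) show ?thesis
      by (intro exI[of _ n]) (simp add: field_simps)
  qed
  define H where "H = {n. of_nat n / of_nat D \<in> M}"
  have MH: "M = (\<lambda>n. of_nat n / of_nat D) ` H"
    using nat by (auto simp: H_def)
  have "submonoid H (additive UNIV)"
    using M(1,2) by (auto simp: submonoid_additive_UNIV_iff H_def add_divide_distrib)
  moreover have "H \<noteq> {0}"
    using MH assms(2) by auto
  ultimately obtain g N where g: "g > 0" "numerical_semigroup N" "H = (\<lambda>n. g * n) ` N"
    using nat_submonoid_eq_multiple_of_numerical_semigroup by blast
  have "M = (\<lambda>n. of_nat n * (of_nat g / of_nat D)) ` N"
    unfolding MH g(3) by (simp add: image_image mult.commute)
  with g(1,2) D(1) show ?thesis
    by (intro isomorphic_to_numerical_semigroup_if_scaled[of "of_nat g / of_nat D" N]) auto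
qed

section \<open>From numerical semigroups to atomic monoids\<close>

lemma atomic_if_nat_valued_additive:
  fixes f :: "rat \<Rightarrow> nat"
  assumes add: "\<And>x y. x \<in> M \<Longrightarrow> y \<in> M \<Longrightarrow> f (x + y) = f x + f y"
    and pos: "\<And>x. x \<in> M \<Longrightarrow> x \<noteq> 0 \<Longrightarrow> f x > 0"
  shows "atomic M"
proof -
  have "\<exists>A. set_mset A \<subseteq> atoms M \<and> m = \<Sum>\<^sub># A" if "m \<in> M" "m \<noteq> 0" for m
    using that
  proof (induction "f m" arbitrary: m rule: less_induct)
    case less
    show ?case
    proof (cases "m \<in> atoms M")
      case True
      then show ?thesis
        by (intro exI[of _ "{#m#}"]) simp
    next
      case False
      with less.prems obtain x y where xy: "x \<in> M" "y \<in> M" "m = x + y" "x \<noteq> 0" "y \<noteq> 0"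
        by (auto simp: atoms_def)
      then have "f x < f m" "f y < f m"
        using add pos by auto
      with less.hyps xy obtain A B
        where "set_mset A \<subseteq> atoms M" "x = \<Sum>\<^sub># A" "set_mset B \<subseteq> atoms M" "y = \<Sum>\<^sub># B"
        by metis
      with xy(3) show ?thesis
        by (intro exI[of _ "A + B"]) simp
    qed
  qed
  then show ?thesis
    by (simp add: atomic_def)
qed

lemma atomic_if_isomorphic_to_numerical_semigroup:
  assumes "0 \<in> M" "isomorphic_to_numerical_semigroup M"
  shows "atomic M"
proof -
  obtain N f where f: "f \<in> iso (additive M) (additive (N :: nat set))"
    using assms(2) by (auto simp: isomorphic_to_numerical_semigroup_def is_iso_def)
  have add: "f (x + y) = f x + f y" if "x \<in> M" "y \<in> M" for x y
    using f that by (auto simp: iso_def hom_def additive_def)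
  have "inj_on f M"
    using f by (auto simp: iso_def additive_def bij_betw_def)
  have "f 0 = 0"
    using add[OF assms(1) assms(1)] by simp
  then have "f x > 0" if "x \<in> M" "x \<noteq> 0" for x
    using inj_onD[OF \<open>inj_on f M\<close>, of x 0] assms(1) that by fastforce
  with add show ?thesis
    by (rule atomic_if_nat_valued_additive)
qed

section \<open>The characterization\<close>

theorem theorem5p8:
  fixes M :: "rat set"
  assumes "strongly_bounded M"
    and "finite_puiseux_monoid M"
    and "M \<noteq> {0}"
  shows "atomic M \<longleftrightarrow> isomorphic_to_numerical_semigroup M"
proof
  have M: "puiseux_monoid M"
    using assms(1) by (simp add: strongly_bounded_def)
  show "isomorphic_to_numerical_semigroup M" if "atomic M"
    using M assms(3) that finite_atoms[OF assms(1,2)]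
    by (rule isomorphic_to_numerical_semigroup_if_finite_atoms)
  show "atomic M" if "isomorphic_to_numerical_semigroup M"
    using M that
    by (intro atomic_if_isomorphic_to_numerical_semigroup) (auto simp: puiseux_monoid_iff)
qed

end
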